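(* Let $P=(p_{lm})$ be an $n\times n$ row substochastic matrix of spectral radius less than $1$, let $I$ be the $n\times n$ identity matrix, and let $C=(c_{ml})=(I-P^T)^{-1}$. Then the diagonal elements of $C$ are maximal elements of their respective rows, i.e. $c_{ml}\le c_{mm}$ for all $m,l\in\{1,\dots,n\}$.
   Context: A real $n\times n$ matrix $P=(p_{lm})$ is called row substochastic if all $p_{lm}\ge 0$ and $\sum_{m=1}^n p_{lm}\le 1$ for every $l$. $P^T$ denotes the transpose of $P$. *)

theory Defs
  imports
    "Jordan_Normal_Form.Spectral_Radius"
    "Jordan_Normal_Form.Gauss_Jordan_Elimination"
begin

definition row_substochastic :: "nat \<Rightarrow> real mat \<Rightarrow> bool" where
  "row_substochastic n P \<longleftrightarrow>
     P \<in> carrier_mat n n \<and>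
     (\<forall>l<n. \<forall>m<n. 0 \<le> P $$ (l, m)) \<and>
     (\<forall>l<n. (\<Sum>m<n. P $$ (l, m)) \<le> 1)"

text \<open>The library's \<open>spectral_radius\<close> is defined for complex matrices only; the spectral
  radius of a real matrix is taken over its complex eigenvalues.\<close>

definition real_spectral_radius :: "real mat \<Rightarrow> real" where
  "real_spectral_radius A = spectral_radius (map_mat complex_of_real A)"

end

theory Submission
  imports Defs
begin

text \<open>
  Put \<open>A = I - P\<^sup>T\<close>, which is invertible because \<open>det A = 0\<close> would make \<open>1\<close> an eigenvalue
  of \<open>P\<close>.  Let \<open>x\<close> be row \<open>m\<close> of \<open>C = A\<inverse>\<close>.  Reading \<open>C A = I\<close> along this row gives
  \<open>x = P x + e\<^sub>m\<close>: regard \<open>P\<close> as the transition matrix of a killed random walk; then \<open>x\<close> is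
  harmonic except at the state \<open>m\<close>, and the claim is a maximum principle: such an \<open>x\<close> attains its
  maximum at \<open>m\<close>.

  The reason is the usual one.  Where a function with a positive maximum attains it, being at most
  the \<open>P\<close>-average there forces the walk to survive and to stay in the set \<open>S\<close> of maximum points.
  If this happened on all of \<open>S\<close>, the walk would never be killed once in \<open>S\<close>, and
  \<open>P\<close> restricted to \<open>S\<close> would be stochastic.  To exclude that, no powers of \<open>P\<close> or
  eigenvectors are needed, only one function \<open>y\<close> with \<open>y > P y\<close>, since a
  stochastic average over \<open>S\<close> is never below the minimum of \<open>y\<close> on \<open>S\<close>.  Such a \<open>y\<close> comes with the
  inverse: the column sums of \<open>C\<close> satisfy \<open>y = P y + 1\<close>.

  Applied to \<open>-x\<close>, the same principle (\<open>positive_maximum_strictly_superharmonic\<close>) shows that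
  \<open>x\<close> is nonnegative; applied to \<open>x\<close>, it locates the maximum (\<open>green_function_le_diagonal\<close>).
\<close>

text \<open>The maximum principle.  The role of \<open>y\<close> is to rule out a set of states that the walk never
  leaves and on which it is never killed; on such a set the indicator function would be a
  counterexample.\<close>

lemma positive_maximum_strictly_superharmonic:
  fixes p :: "'a \<Rightarrow> 'a \<Rightarrow> real" and w y :: "'a \<Rightarrow> real"
  assumes fin: "finite I"
    and nonneg: "\<And>l j. l \<in> I \<Longrightarrow> j \<in> I \<Longrightarrow> 0 \<le> p l j"
    and row_le: "\<And>l. l \<in> I \<Longrightarrow> (\<Sum>j\<in>I. p l j) \<le> 1"
    and y: "\<And>l. l \<in> I \<Longrightarrow> (\<Sum>j\<in>I. p l j * y j) < y l"
    and k: "k \<in> I" "0 < w k" "\<And>j. j \<in> I \<Longrightarrow> w j \<le> w k"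
  shows "\<exists>l\<in>I. w l = w k \<and> (\<Sum>j\<in>I. p l j * w j) < w l"
proof (rule ccontr)
  assume no: "\<not> ?thesis"
  define S where "S = {l \<in> I. w l = w k}"
  have finS: "finite S" and "S \<noteq> {}" and SI: "S \<subseteq> I"
    using fin k(1) by (auto simp: S_def)
  \<comment> \<open>At a minimum point of \<open>y\<close> on \<open>S\<close>, a stochastic average over \<open>S\<close> cannot lie strictly below \<open>y\<close>.\<close>
  have "Min (y ` S) \<in> y ` S"
    using finS \<open>S \<noteq> {}\<close> by (intro Min_in) auto
  then obtain l where l: "l \<in> S" "y l = Min (y ` S)"
    by auto
  have lI: "l \<in> I" using l(1) SI by auto
  have min: "y l \<le> y j" if "j \<in> S" for j
    using that finS l(2) by simp
  have avg: "w k \<le> (\<Sum>j\<in>I. p l j * w j)"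
    using no l(1) by (auto simp: S_def not_less)
  \<comment> \<open>All terms of this sum are nonnegative, while \<open>avg\<close> and \<open>row_le\<close> bound the sum by zero.\<close>
  have defect: "(\<Sum>j\<in>I. p l j * (w k - w j)) = w k * (\<Sum>j\<in>I. p l j) - (\<Sum>j\<in>I. p l j * w j)"
    by (simp add: right_diff_distrib sum_subtractf sum_distrib_left mult.commute)
  have defect_terms: "0 \<le> p l j * (w k - w j)" if "j \<in> I" for j
    using nonneg[OF lI that] k(3)[OF that] by simp
  have defect_nonneg: "0 \<le> (\<Sum>j\<in>I. p l j * (w k - w j))"
    using defect_terms by (rule sum_nonneg)
  have le: "w k * (\<Sum>j\<in>I. p l j) \<le> w k * 1"
    using row_le[OF lI] k(2) by (intro mult_left_mono) auto
  have survive: "(\<Sum>j\<in>I. p l j) = 1"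
  proof -
    have "w k * 1 \<le> w k * (\<Sum>j\<in>I. p l j)"
      using avg defect defect_nonneg by linarith
    then have "1 \<le> (\<Sum>j\<in>I. p l j)"
      using k(2) by (simp only: mult_le_cancel_left_pos)
    with row_le[OF lI] show ?thesis by simp
  qed
  have "(\<Sum>j\<in>I. p l j * (w k - w j)) = 0"
    using avg defect defect_nonneg le by linarith
  then have "\<forall>j\<in>I. p l j * (w k - w j) = 0"
    using fin defect_terms by (simp add: sum_nonneg_eq_0_iff)
  then have stay: "p l j = 0" if "j \<in> I" "j \<notin> S" for j
    using that by (auto simp: S_def)
  have "y l = (\<Sum>j\<in>I. p l j * y l)"
    using survive by (simp flip: sum_distrib_right)
  also have "\<dots> \<le> (\<Sum>j\<in>I. p l j * y j)"
  proof (rule sum_mono)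
    fix j assume j: "j \<in> I"
    show "p l j * y l \<le> p l j * y j"
      using stay[OF j] min nonneg[OF lI j] by (cases "j \<in> S") (auto intro: mult_left_mono)
  qed
  finally show False
    using y[OF lI] by simp
qed

text \<open>A solution \<open>x\<close> of \<open>x = P x + e\<^sub>m\<close> records the expected number of visits to \<open>m\<close>, as a function of
  the starting state: no start sees more visits than \<open>m\<close> itself.\<close>

lemma green_function_le_diagonal:
  fixes p :: "'a \<Rightarrow> 'a \<Rightarrow> real" and x y :: "'a \<Rightarrow> real"
  assumes fin: "finite I"
    and nonneg: "\<And>l j. l \<in> I \<Longrightarrow> j \<in> I \<Longrightarrow> 0 \<le> p l j"
    and row_le: "\<And>l. l \<in> I \<Longrightarrow> (\<Sum>j\<in>I. p l j) \<le> 1"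
    and y: "\<And>l. l \<in> I \<Longrightarrow> (\<Sum>j\<in>I. p l j * y j) < y l"
    and x: "\<And>l. l \<in> I \<Longrightarrow> x l = (\<Sum>j\<in>I. p l j * x j) + (if l = m then 1 else 0)"
    and m: "m \<in> I" and l: "l \<in> I"
  shows "x l \<le> x m"
proof -
  note max_principle = positive_maximum_strictly_superharmonic[OF fin nonneg row_le y]
  have attains: "\<exists>k\<in>I. \<forall>j\<in>I. f j \<le> f k" for f :: "'a \<Rightarrow> real"
  proof -
    have "Max (f ` I) \<in> f ` I"
      using fin m by (intro Max_in) auto
    then obtain k where "k \<in> I" "f k = Max (f ` I)" by auto
    then show ?thesis using fin by (intro bexI[of _ k]) auto
  qed
  have x_nonneg: "0 \<le> x j" if j: "j \<in> I" for j
  proof (rule ccontr)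
    assume neg: "\<not> 0 \<le> x j"
    obtain k where k: "k \<in> I" "\<forall>i\<in>I. - x i \<le> - x k"
      using attains[of "\<lambda>i. - x i"] by auto
    have "0 < - x k" using k(2) j neg by force
    then obtain i where "i \<in> I" "(\<Sum>j\<in>I. p i j * (- x j)) < - x i"
      using max_principle[of k "\<lambda>i. - x i"] k by auto
    then show False
      using x[of i] by (simp add: sum_negf split: if_splits)
  qed
  obtain k where k: "k \<in> I" "\<forall>i\<in>I. x i \<le> x k"
    using attains by auto
  show ?thesis
  proof (cases "0 < x k")
    case True
    then obtain i where "i \<in> I" "x i = x k" "(\<Sum>j\<in>I. p i j * x j) < x i"
      using max_principle[of k x] k by auto
    moreover from this have "i = m"
      using x[of i] by (auto split: if_splits)
    ultimately show ?thesis using k(2) l by auto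
  next
    case False
    then have "x l \<le> 0" using k(2) l by force
    then show ?thesis using x_nonneg[OF m] by linarith
  qed
qed

lemma det_one_minus_nonzero:
  fixes P :: "real mat"
  assumes P: "P \<in> carrier_mat n n" and sr: "real_spectral_radius P < 1"
  shows "det (1\<^sub>m n - P) \<noteq> 0"
proof
  assume det0: "det (1\<^sub>m n - P) = 0"
  let ?Q = "map_mat complex_of_real P"
  have Q: "?Q \<in> carrier_mat n n" using P by simp
  have "- char_matrix ?Q 1 = map_mat complex_of_real (1\<^sub>m n - P)"
    using P by (intro eq_matI) (auto simp: char_matrix_def)
  then have "poly (char_poly ?Q) 1 = 0"
    using det0 by (simp add: char_poly_matrix[OF Q] of_real_hom.hom_det)
  then have ev: "eigenvalue ?Q 1"
    by (simp add: eigenvalue_root_char_poly[OF Q])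
  then have "norm (1 :: complex) \<in> norm ` spectrum ?Q"
    unfolding spectrum_def by (intro imageI) simp
  from spectral_radius_mem_max(2)[OF Q eigenvalue_imp_nonzero_dim[OF Q ev] this] sr
  show False by (simp add: real_spectral_radius_def)
qed

text \<open>Each row of a left inverse of \<open>I - P\<^sup>T\<close> solves \<open>x = P x + e\<^sub>m\<close>: the transposition turns
  multiplication from the right into the action of \<open>P\<close> on functions.\<close>

lemma left_inverse_row_equation:
  fixes P C :: "'a :: comm_ring_1 mat"
  assumes P: "P \<in> carrier_mat n n" and C: "C \<in> carrier_mat n n"
    and inv: "C * (1\<^sub>m n - transpose_mat P) = 1\<^sub>m n"
    and m: "m < n" and l: "l < n"
  shows "C $$ (m, l) = (\<Sum>j<n. P $$ (l, j) * C $$ (m, j)) + (if l = m then 1 else 0)"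
proof -
  have "(if m = l then 1 else 0) = (C * (1\<^sub>m n - transpose_mat P)) $$ (m, l)"
    using inv m l by simp
  also have "\<dots> = (\<Sum>j<n. C $$ (m, j) * ((if j = l then 1 else 0) - P $$ (l, j)))"
    using P C m l by (auto simp: scalar_prod_def atLeast0LessThan intro!: sum.cong)
  also have "\<dots> = (\<Sum>j<n. if j = l then C $$ (m, j) else 0) - (\<Sum>j<n. P $$ (l, j) * C $$ (m, j))"
    unfolding sum_subtractf[symmetric] by (intro sum.cong) (auto simp: algebra_simps)
  also have "(\<Sum>j<n. if j = l then C $$ (m, j) else 0) = C $$ (m, l)"
    using l by simp
  finally show ?thesis by (auto simp: algebra_simps split: if_splits)
qed

theorem theorem1:
  fixes n :: nat and P :: "real mat"
  assumes "n \<ge> 1"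
    and "row_substochastic n P"
    and "real_spectral_radius P < 1"
  shows "\<exists>C. mat_inverse (1\<^sub>m n - transpose_mat P) = Some C \<and>
             (\<forall>m<n. \<forall>l<n. C $$ (m, l) \<le> C $$ (m, m))"
proof -
  let ?A = "1\<^sub>m n - transpose_mat P"
  have P: "P \<in> carrier_mat n n"
    and nonneg: "\<And>l j. l < n \<Longrightarrow> j < n \<Longrightarrow> 0 \<le> P $$ (l, j)"
    and row_le: "\<And>l. l < n \<Longrightarrow> (\<Sum>j<n. P $$ (l, j)) \<le> 1"
    using assms(2) by (auto simp: row_substochastic_def)
  have A: "?A \<in> carrier_mat n n" using P by (intro minus_carrier_mat) simp
  have "?A = transpose_mat (1\<^sub>m n - P)"
    using P by (intro eq_matI) auto
  then have "det ?A = det (1\<^sub>m n - P)"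
    using det_transpose[OF minus_carrier_mat[OF P, of "1\<^sub>m n"]] by simp
  then have "det ?A \<noteq> 0"
    using det_one_minus_nonzero[OF P assms(3)] by simp
  then have "mat_inverse ?A \<noteq> None"
    using det_non_zero_imp_unit[OF A, where b = "()"] mat_inverse(1)[OF A, where b = "()"] by blast
  then obtain C where C: "mat_inverse ?A = Some C" by auto
  have CA: "C * ?A = 1\<^sub>m n" and C_carrier: "C \<in> carrier_mat n n"
    using mat_inverse(2)[OF A C] by auto
  note row_eq = left_inverse_row_equation[OF P C_carrier CA]
  define y where "y j = (\<Sum>m<n. C $$ (m, j))" for j
  have y: "(\<Sum>j<n. P $$ (l, j) * y j) < y l" if l: "l < n" for l
  proof -
    have "y l = (\<Sum>m<n. (\<Sum>j<n. P $$ (l, j) * C $$ (m, j)) + (if l = m then 1 else 0))"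
      unfolding y_def by (intro sum.cong refl row_eq) (use l in auto)
    also have "\<dots> = (\<Sum>m<n. \<Sum>j<n. P $$ (l, j) * C $$ (m, j)) + 1"
      using l by (simp add: sum.distrib)
    also have "(\<Sum>m<n. \<Sum>j<n. P $$ (l, j) * C $$ (m, j)) = (\<Sum>j<n. P $$ (l, j) * y j)"
      unfolding y_def sum_distrib_left by (rule sum.swap)
    finally show ?thesis by simp
  qed
  have "C $$ (m, l) \<le> C $$ (m, m)" if m: "m < n" and l: "l < n" for m l
  proof (rule green_function_le_diagonal[where I = "{..<n}" and p = "\<lambda>l j. P $$ (l, j)"
        and x = "\<lambda>l. C $$ (m, l)" and y = y])
    show "C $$ (m, i) = (\<Sum>j<n. P $$ (i, j) * C $$ (m, j)) + (if i = m then 1 else 0)"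
      if "i \<in> {..<n}" for i
      using that by (intro row_eq m) simp
  qed (use nonneg row_le y m l in auto)
  with C show ?thesis by blast
qed

end
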